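(* Let $m,d\geq 1$ and suppose that $\mathsf{A}=\{A_0,\ldots,A_{m-1}\}\subset M_d(\mathbb{R})$ satisfies $\varrho(\mathsf{A})=1$. Define two matrices $B_0,B_1\in M_{md}(\mathbb{R})$, written as $m\times m$ arrays of $d\times d$ blocks with block rows and columns indexed by $0,\ldots,m-1$, as follows: the $(i,j)$ block of $B_0$ is the $d\times d$ identity matrix $I$ if $i\equiv j+1 \pmod m$ and is zero otherwise (so $B_0$ has identity blocks immediately below the diagonal and in the top right corner), and $B_1$ is block diagonal with diagonal blocks $A_0,A_1,\ldots,A_{m-1}$ in this order. Let $\mathsf{B}:=\{B_0,B_1\}\subset M_{md}(\mathbb{R})$. Then $\varrho(\mathsf{B})=1$. Moreover, if $(a_n)$ and $(b_n)$ denote the marginal instability rate sequences of $\mathsf{A}$ and $\mathsf{B}$ respectively (with respect to any norms on $M_d(\mathbb{R})$ and $M_{md}(\mathbb{R})$), then the following hold: (a) Let $(\gamma_n)_{n=1}^\infty$ be a weakly increasing, weakly upper regularly varying sequence of positive real numbers and $(n_\ell)_{\ell=1}^\infty$ a strictly increasing sequence of natural numbers such that the ratio $n_{\ell+1}/n_\ell$ is bounded above independently of $\ell$. Suppose that $a_n\lesssim\gamma_n$ and $\gamma_{n_\ell}\lesssim a_{n_\ell}$. Then $b_n\simeq\gamma_n$. (b) Suppose that $(a_n)$ is weakly increasing and weakly upper regularly varying. Then $b_n\simeq a_n$.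
   Context: $M_d(\mathbb{R})$ is the set of $d\times d$ real matrices and $\|\cdot\|$ is the Euclidean operator norm. For $\mathsf{A}\subset M_d(\mathbb{R})$ and $n\geq 1$, $\mathsf{A}_n:=\{A_1\cdots A_n\colon A_i\in\mathsf{A}\}$ (products of $n$ elements of $\mathsf{A}$). The joint spectral radius of a bounded nonempty set $\mathsf{A}$ is $\varrho(\mathsf{A})=\lim_{n\to\infty}\sup_{A\in\mathsf{A}_n}\|A\|^{1/n}$. If $\varrho(\mathsf{A})=1$, the marginal instability rate sequence of $\mathsf{A}$ with respect to a norm $|||\cdot|||$ on $M_d(\mathbb{R})$ is $(a_n)_{n=1}^\infty$ with $a_n=\max_{A\in\mathsf{A}_n}|||A|||$. For sequences of positive reals, $a_n\lesssim b_n$ means there is $C>0$ with $a_n\leq Cb_n$ for all $n\geq 1$; $a_n\simeq b_n$ means $a_n\lesssim b_n$ and $b_n\lesssim a_n$. Along a subsequence, $a_{n_\ell}\lesssim b_{n_\ell}$ means there is $C>0$ with $a_{n_\ell}\leq Cb_{n_\ell}$ for all $\ell\geq 1$. A sequence $(a_n)$ of positive reals is weakly increasing if there exists $\kappa>0$ such that $a_{n+m}\geq\kappa a_n$ for all $n,m\geq 1$. It is weakly upper regularly varying if for every $m\geq 1$ there exists $C_m>0$ such that $a_{nm}\leq C_ma_n$ for all $n\geq 1$. *)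

theory Defs
  imports "HOL-Analysis.Analysis"
begin

definition is_norm :: "('a::real_vector \<Rightarrow> real) \<Rightarrow> bool" where
  "is_norm N \<longleftrightarrow>
     (\<forall>x. N x \<ge> 0) \<and> (\<forall>x. N x = 0 \<longleftrightarrow> x = 0) \<and>
     (\<forall>c x. N (c *\<^sub>R x) = \<bar>c\<bar> * N x) \<and>
     (\<forall>x y. N (x + y) \<le> N x + N y)"

definition products :: "(real^'n^'n) set \<Rightarrow> nat \<Rightarrow> (real^'n^'n) set" where
  "products S n = {foldr (**) As (mat 1) | As. length As = n \<and> set As \<subseteq> S}"

text \<open>The limit exists for every bounded nonempty set of matrices; the norm on
  \<^typ>\<open>real^'n\<close> is the Euclidean one, so \<^const>\<open>onorm\<close> gives the Euclidean operator norm.\<close>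

definition joint_spectral_radius :: "(real^'n^'n) set \<Rightarrow> real" where
  "joint_spectral_radius S = lim (\<lambda>n. SUP X\<in>products S n. root n (onorm ((*v) X)))"

text \<open>For finite (more generally compact) nonempty \<open>S\<close> the supremum is a maximum.\<close>

definition marginal_rate :: "(real^'n^'n \<Rightarrow> real) \<Rightarrow> (real^'n^'n) set \<Rightarrow> nat \<Rightarrow> real" where
  "marginal_rate N S n = (SUP X\<in>products S n. N X)"

text \<open>Sequences are indexed by \<open>n \<ge> 1\<close> throughout; their values at \<open>0\<close> play no role.\<close>

definition lesssim :: "(nat \<Rightarrow> real) \<Rightarrow> (nat \<Rightarrow> real) \<Rightarrow> bool"  (infix \<open>\<lesssim>\<close> 50) where
  "a \<lesssim> b \<longleftrightarrow> (\<exists>C>0. \<forall>n\<ge>1. a n \<le> C * b n)"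

definition simeq :: "(nat \<Rightarrow> real) \<Rightarrow> (nat \<Rightarrow> real) \<Rightarrow> bool"  (infix \<open>\<simeq>\<close> 50) where
  "a \<simeq> b \<longleftrightarrow> a \<lesssim> b \<and> b \<lesssim> a"

definition weakly_increasing :: "(nat \<Rightarrow> real) \<Rightarrow> bool" where
  "weakly_increasing a \<longleftrightarrow> (\<exists>\<kappa>>0. \<forall>n\<ge>1. \<forall>m\<ge>1. a (n + m) \<ge> \<kappa> * a n)"

definition weakly_upper_regularly_varying :: "(nat \<Rightarrow> real) \<Rightarrow> bool" where
  "weakly_upper_regularly_varying a \<longleftrightarrow>
     (\<forall>m\<ge>1. \<exists>C>0. \<forall>n\<ge>1. a (n * m) \<le> C * a n)"

text \<open>A matrix with index type \<^typ>\<open>'k \<times> 'd\<close> is a \<open>'k\<close>-by-\<open>'k\<close> array of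
  \<open>'d\<close>-by-\<open>'d\<close> blocks.\<close>

definition block_matrix ::
  "('k \<Rightarrow> 'k \<Rightarrow> real^'d^'d) \<Rightarrow> real^('k::finite \<times> 'd::finite)^('k \<times> 'd)" where
  "block_matrix M = (\<chi> p q. M (fst p) (fst q) $ snd p $ snd q)"

text \<open>Below \<open>e\<close> is a bijection from \<open>'k\<close> onto \<open>{0..<m}\<close>, numbering the block rows and
  columns.\<close>

definition shift_matrix ::
  "nat \<Rightarrow> ('k \<Rightarrow> nat) \<Rightarrow> real^('k::finite \<times> 'd::finite)^('k \<times> 'd)" where
  "shift_matrix m e =
     block_matrix (\<lambda>i j. if e i mod m = (e j + 1) mod m then mat 1 else 0)"

definition block_diagonal ::
  "('k \<Rightarrow> nat) \<Rightarrow> (nat \<Rightarrow> real^'d^'d) \<Rightarrow> real^('k::finite \<times> 'd::finite)^('k \<times> 'd)" where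
  "block_diagonal e A = block_matrix (\<lambda>i j. if i = j then A (e i) else 0)"

end

theory Submission
  imports Defs
begin

text \<open>Every product of \<open>n\<close> factors from \<open>{B0, B1}\<close> is a block permutation matrix whose nonzero
  blocks are products of \<open>k\<close> of the \<open>A\<^sub>i\<close>, where \<open>k \<le> n\<close> is the number of factors \<open>B1\<close>; hence
  \<open>b n\<close> is bounded by a multiple of \<open>max {a k | k \<le> n}\<close>. Conversely at most \<open>m - 1\<close> shifts
  \<open>B0\<close> bring any prescribed \<open>A\<^sub>i\<close> into a given block row, so each product of \<open>k\<close> of
  the \<open>A\<^sub>i\<close> occurs as a block of a product of any length \<open>n \<ge> m k\<close>, whence \<open>b n\<close> dominates a
  multiple of \<open>a k\<close>. All claims follow from these two comparisons; for the
  joint spectral radius, Fekete's lemma supplies the existence of the limit.\<close>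

section \<open>Norms on finite-dimensional spaces\<close>

lemma le_mult_trans:
  fixes x :: "'a::ordered_semiring"
  shows "x \<le> c * y \<Longrightarrow> y \<le> z \<Longrightarrow> 0 \<le> c \<Longrightarrow> x \<le> c * z"
  using mult_left_mono order_trans by blast

lemma is_norm_le_norm:
  fixes N :: "'a::euclidean_space \<Rightarrow> real"
  assumes "is_norm N"
  shows "\<exists>C>0. \<forall>x. N x \<le> C * norm x"
proof -
  have nn: "N x \<ge> 0" and sc: "N (c *\<^sub>R x) = \<bar>c\<bar> * N x" and tri: "N (x + y) \<le> N x + N y"
    for x y c
    using assms unfolding is_norm_def by blast+
  have N0: "N 0 = 0" using assms unfolding is_norm_def by blast
  have sum: "N (sum f S) \<le> (\<Sum>b\<in>S. N (f b))" if "finite S" for f :: "'a \<Rightarrow> 'a" and S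
    using that
  proof induction
    case (insert x F)
    then show ?case using tri[of "f x" "sum f F"] by simp
  qed (simp add: N0)
  \<comment> \<open>The constant comes from expanding \<open>x\<close> in the orthonormal basis; the
    summand 1 makes its positivity immediate.\<close>
  have "N x \<le> (1 + (\<Sum>b\<in>Basis. N b)) * norm x" for x
  proof -
    have "N x = N (\<Sum>b\<in>Basis. (x \<bullet> b) *\<^sub>R b)" by (simp add: euclidean_representation)
    also have "\<dots> \<le> (\<Sum>b\<in>Basis. N ((x \<bullet> b) *\<^sub>R b))" by (rule sum) simp
    also have "\<dots> \<le> (\<Sum>b\<in>Basis. norm x * N b)"
      by (rule sum_mono) (simp add: sc Basis_le_norm mult_right_mono nn)
    also have "\<dots> = norm x * (\<Sum>b\<in>Basis. N b)" by (simp add: sum_distrib_left)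
    also have "\<dots> \<le> (1 + (\<Sum>b\<in>Basis. N b)) * norm x" by (simp add: algebra_simps)
    finally show ?thesis .
  qed
  moreover have "1 + (\<Sum>b\<in>Basis. N b) > 0" by (simp add: add_pos_nonneg nn sum_nonneg)
  ultimately show ?thesis by blast
qed

text \<open>Compactness: \<open>N\<close> is Lipschitz by the reverse triangle inequality, so it
  attains a positive minimum on the unit sphere, and homogeneity carries the bound to all
  vectors.\<close>

lemma norm_le_is_norm:
  fixes N :: "'a::euclidean_space \<Rightarrow> real"
  assumes "is_norm N"
  shows "\<exists>C>0. \<forall>x. norm x \<le> C * N x"
proof -
  have nn: "N x \<ge> 0" and sc: "N (c *\<^sub>R x) = \<bar>c\<bar> * N x" and tri: "N (x + y) \<le> N x + N y"
    and z: "N x = 0 \<longleftrightarrow> x = 0" for x y c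
    using assms unfolding is_norm_def by blast+
  obtain C where C: "C > 0" "\<And>x. N x \<le> C * norm x" using is_norm_le_norm[OF assms] by blast
  have lip: "\<bar>N x - N y\<bar> \<le> C * dist x y" for x y
  proof -
    have "N x \<le> N (x - y) + N y" using tri[of "x - y" y] by simp
    moreover have "N y \<le> N (y - x) + N x" using tri[of "y - x" x] by simp
    ultimately show ?thesis
      using C(2)[of "x - y"] C(2)[of "y - x"] by (simp add: dist_norm norm_minus_commute)
  qed
  have "C-lipschitz_on UNIV N"
    by (rule lipschitz_onI) (use lip C in \<open>auto simp: dist_real_def\<close>)
  then have cont: "continuous_on (sphere 0 1) N"
    using lipschitz_on_continuous_on continuous_on_subset by blast
  have "(sphere 0 1 :: 'a set) \<noteq> {}" by simp
  then obtain w where w: "w \<in> sphere 0 1" "\<forall>y\<in>sphere 0 1. N w \<le> N y"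
    using continuous_attains_inf[OF compact_sphere _ cont] by blast
  have pos: "N w > 0" using w(1) z[of w] nn[of w] by (auto simp: less_le)
  have "norm x \<le> (1 / N w) * N x" for x
  proof (cases "x = 0")
    case False
    then have "N w \<le> N ((1 / norm x) *\<^sub>R x)" using w(2) by simp
    also have "\<dots> = N x / norm x" by (simp add: sc)
    finally show ?thesis using False pos by (simp add: field_simps)
  qed (use pos nn in simp)
  then show ?thesis using pos by (intro exI[of _ "1 / N w"]) auto
qed

lemma is_norm_equivalent:
  fixes N N' :: "'a::euclidean_space \<Rightarrow> real"
  assumes "is_norm N" "is_norm N'"
  shows "\<exists>C>0. \<forall>x. N x \<le> C * N' x"
proof -
  obtain C where C: "C > 0" "\<And>x. N x \<le> C * norm x" using is_norm_le_norm[OF assms(1)] by blast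
  obtain D where D: "D > 0" "\<And>x. norm x \<le> D * N' x" using norm_le_is_norm[OF assms(2)] by blast
  have "N x \<le> (C * D) * N' x" for x
    using le_mult_trans[OF C(2) D(2)] C(1) by (simp add: mult.assoc)
  then show ?thesis using C(1) D(1) by (intro exI[of _ "C * D"]) auto
qed

text \<open>Makes the comparisons of rates, stated for arbitrary norms, available for the operator
  norm in the joint spectral radius.\<close>

lemma is_norm_onorm: "is_norm (\<lambda>X :: real^'n^'m. onorm ((*v) X))"
proof -
  have bl: "bounded_linear ((*v) X)" for X :: "real^'n^'m"
    by (rule matrix_vector_mul_bounded_linear)
  have z: "onorm ((*v) X) = 0 \<longleftrightarrow> X = 0" for X :: "real^'n^'m"
    by (simp add: onorm_eq_0[OF bl] matrix_eq)
  have s: "onorm ((*v) (c *\<^sub>R X)) = \<bar>c\<bar> * onorm ((*v) X)" for c and X :: "real^'n^'m"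
    using onorm_scaleR[OF bl, of c X] by (simp add: scaleR_matrix_vector_assoc)
  have t: "onorm ((*v) (X + Y)) \<le> onorm ((*v) X) + onorm ((*v) Y)" for X Y :: "real^'n^'m"
    using onorm_triangle[OF bl bl, of X Y] by (simp add: matrix_vector_mult_add_rdistrib[abs_def])
  show ?thesis unfolding is_norm_def using z s t onorm_pos_le[OF bl] by blast
qed

text \<open>Together with \<open>matrix_entry_le_norm\<close> this compares the norms of a large
  matrix and of its blocks through single entries, at the cost of a dimension factor.\<close>

lemma norm_matrix_le:
  fixes X :: "real^'n^'m"
  assumes "\<And>i j. \<bar>X $ i $ j\<bar> \<le> t"
  shows "norm X \<le> real CARD('m) * (real CARD('n) * t)"
proof -
  have "norm (X $ i) \<le> real CARD('n) * t" for i
    using norm_le_l1_cart[of "X $ i"] sum_bounded_above[of UNIV "\<lambda>j. \<bar>X $ i $ j\<bar>" t] assms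
    by fastforce
  moreover have "norm X \<le> (\<Sum>i\<in>UNIV. norm (X $ i))"
    unfolding norm_vec_def by (rule L2_set_le_sum) simp
  ultimately show ?thesis
    using sum_bounded_above[of UNIV "\<lambda>i. norm (X $ i)" "real CARD('n) * t"] by fastforce
qed

lemma matrix_entry_le_norm: "\<bar>X $ i $ j\<bar> \<le> norm (X :: real^'n^'m)"
  using component_le_norm_cart[of "X $ i" j] Finite_Cartesian_Product.norm_nth_le[of X i] by linarith

section \<open>Products and marginal rates\<close>

lemma products_0: "products S 0 = {mat 1}"
  by (auto simp: products_def)

lemma products_Suc: "products S (Suc n) = {Y ** X | Y X. Y \<in> S \<and> X \<in> products S n}"
proof (intro set_eqI iffI)
  fix Z assume "Z \<in> products S (Suc n)"
  then obtain As where "Z = foldr (**) As (mat 1)" "length As = Suc n" "set As \<subseteq> S"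
    by (auto simp: products_def)
  then show "Z \<in> {Y ** X | Y X. Y \<in> S \<and> X \<in> products S n}"
    by (cases As) (auto simp: products_def)
next
  fix Z assume "Z \<in> {Y ** X | Y X. Y \<in> S \<and> X \<in> products S n}"
  then obtain Y As where "Y \<in> S" "Z = Y ** foldr (**) As (mat 1)" "length As = n" "set As \<subseteq> S"
    by (auto simp: products_def)
  then show "Z \<in> products S (Suc n)"
    unfolding products_def by (intro CollectI exI[of _ "Y # As"]) auto
qed

lemma products_add:
  "Z \<in> products S (n + k) \<Longrightarrow> \<exists>X\<in>products S n. \<exists>Y\<in>products S k. Z = X ** Y"
proof (induction n arbitrary: Z)
  case (Suc n)
  then obtain W Z' where W: "W \<in> S" "Z' \<in> products S (n + k)" "Z = W ** Z'"
    by (auto simp: products_Suc)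
  then obtain X Y where "X \<in> products S n" "Y \<in> products S k" "Z' = X ** Y"
    using Suc.IH by blast
  with W show ?case
    by (intro bexI[of _ "W ** X"] bexI[of _ Y]) (auto simp: products_Suc matrix_mul_assoc)
qed (simp add: products_0)

lemma finite_products: "finite S \<Longrightarrow> finite (products S n)"
proof (induction n)
  case (Suc n)
  have "products S (Suc n) = (\<lambda>(Y, X). Y ** X) ` (S \<times> products S n)"
    by (auto simp: products_Suc)
  then show ?case using Suc by simp
qed (simp add: products_0)

lemma products_nonempty: "S \<noteq> {} \<Longrightarrow> products S n \<noteq> {}"
  by (induction n) (auto simp: products_0 products_Suc)

lemma marginal_rate_upper:
  "finite S \<Longrightarrow> X \<in> products S n \<Longrightarrow> N X \<le> marginal_rate N S n"
  unfolding marginal_rate_def by (intro cSUP_upper) (auto simp: finite_products)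

lemma marginal_rate_attained:
  assumes "finite S" "S \<noteq> {}"
  shows "\<exists>X\<in>products S n. marginal_rate N S n = N X"
proof -
  have "finite (N ` products S n)" "N ` products S n \<noteq> {}"
    using assms by (auto simp: finite_products products_nonempty)
  then have "Max (N ` products S n) \<in> N ` products S n"
    "marginal_rate N S n = Max (N ` products S n)"
    by (auto simp: marginal_rate_def cSup_eq_Max intro!: Max_in)
  then show ?thesis by auto
qed

lemma marginal_rate_nonneg:
  "finite S \<Longrightarrow> S \<noteq> {} \<Longrightarrow> is_norm N \<Longrightarrow> marginal_rate N S n \<ge> 0"
  using marginal_rate_attained[of S n N] by (auto simp: is_norm_def)

lemma joint_spectral_radius_eq_lim:
  assumes "finite S" "S \<noteq> {}"
  shows "joint_spectral_radius S =
    lim (\<lambda>n. root n (marginal_rate (\<lambda>X. onorm ((*v) X)) S n))"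
proof -
  have "(SUP X\<in>products S n. root n (onorm ((*v) X))) =
      root n (marginal_rate (\<lambda>X. onorm ((*v) X)) S n)" for n
  proof -
    \<comment> \<open>Monotone maps commute with finite maxima; \<open>root 0\<close> is constantly
      zero, so \<open>n = 0\<close> is no exception.\<close>
    have "mono (root n)"
      by (cases "n = 0") (auto simp: mono_def)
    then show ?thesis
      using mono_Max_commute[of "root n" "(\<lambda>X. onorm ((*v) X)) ` products S n"]
        finite_products[OF assms(1), of n] products_nonempty[OF assms(2), of n]
      by (simp add: marginal_rate_def cSup_eq_Max image_image)
  qed
  then show ?thesis by (simp add: joint_spectral_radius_def)
qed

text \<open>A maximal product of length \<open>n + k\<close> splits into two shorter ones, and the
  operator norm is submultiplicative. An arbitrary norm need not be, hence
  \<open>onorm\<close>.\<close>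

lemma marginal_rate_onorm_submult:
  assumes "finite S" "S \<noteq> {}"
  defines "u \<equiv> marginal_rate (\<lambda>X. onorm ((*v) X)) S"
  shows "u (n + k) \<le> u n * u k"
proof -
  obtain Z where Z: "Z \<in> products S (n + k)" "u (n + k) = onorm ((*v) Z)"
    using marginal_rate_attained[OF assms(1,2)] u_def by metis
  then obtain X Y where XY: "X \<in> products S n" "Y \<in> products S k" "Z = X ** Y"
    using products_add by blast
  have "onorm ((*v) Z) \<le> onorm ((*v) X) * onorm ((*v) Y)"
    using onorm_compose[of "(*v) X" "(*v) Y"] XY(3)
    by (simp add: o_def matrix_vector_mul_assoc matrix_vector_mul_bounded_linear)
  also have "\<dots> \<le> u n * u k"
    unfolding u_def
    by (intro mult_mono marginal_rate_upper marginal_rate_nonneg is_norm_onorm assms XY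
        onorm_pos_le matrix_vector_mul_bounded_linear)
  finally show ?thesis using Z by simp
qed

section \<open>Growth of submultiplicative sequences\<close>

lemma eventually_root_less:
  fixes u :: "nat \<Rightarrow> real"
  assumes "\<And>n. u n \<le> C * r ^ n" "0 < r" "r < y"
  shows "\<forall>\<^sub>F n in sequentially. root n (u n) < y"
proof -
  \<comment> \<open>A positive constant is wanted, so that its \<open>n\<close>-th root tends to
    1.\<close>
  let ?C = "max C 1"
  have "(\<lambda>n. root n ?C * r) \<longlonglongrightarrow> 1 * r"
    by (intro tendsto_intros LIMSEQ_root_const) simp
  then have "\<forall>\<^sub>F n in sequentially. root n ?C * r < y"
    using assms(3) by (intro order_tendstoD(2)[of _ r]) auto
  moreover have "\<forall>\<^sub>F n::nat in sequentially. n > 0" by (rule eventually_gt_at_top)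
  ultimately show ?thesis
  proof eventually_elim
    case (elim n)
    have "u n \<le> ?C * r ^ n"
      using order_trans[OF assms(1)[of n] mult_right_mono[of C ?C "r ^ n"]] assms(2) by simp
    then have "root n (u n) \<le> root n (?C * r ^ n)" using elim by simp
    also have "\<dots> = root n ?C * r"
      using elim assms(2) by (simp add: real_root_mult real_root_power_cancel)
    finally show ?case using elim by simp
  qed
qed

text \<open>Fekete's lemma in multiplicative form; the limit is the infimum over positive indices.
  Working with roots instead of logarithms allows \<open>u\<close> to vanish.\<close>

lemma fekete_root_convergent:
  fixes u :: "nat \<Rightarrow> real"
  assumes nn: "\<And>n. u n \<ge> 0" and sub: "\<And>n k. u (n + k) \<le> u n * u k"
  shows "convergent (\<lambda>n. root n (u n))"
proof -
  define L where "L = (INF n\<in>{1..}. root n (u n))"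
  have bdd: "bdd_below ((\<lambda>n. root n (u n)) ` {1..})"
    by (rule bdd_belowI[of _ 0]) (auto simp: nn)
  have "(\<lambda>n. root n (u n)) \<longlonglongrightarrow> L"
  proof (rule order_tendstoI)
    fix y assume "y < L"
    have "\<forall>\<^sub>F n::nat in sequentially. n \<ge> 1" by (rule eventually_ge_at_top)
    then show "\<forall>\<^sub>F n in sequentially. y < root n (u n)"
    proof eventually_elim
      case (elim n)
      then have "L \<le> root n (u n)" unfolding L_def by (intro cINF_lower bdd) auto
      then show ?case using \<open>y < L\<close> by simp
    qed
  next
    fix y assume "L < y"
    then obtain p where p: "p \<ge> 1" "root p (u p) < y"
      unfolding L_def by (subst (asm) cINF_less_iff[OF _ bdd]) auto
    \<comment> \<open>The strict gap below \<open>r\<close> keeps \<open>r\<close> positive even if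
      \<open>u p = 0\<close>; the gap above it absorbs the constant \<open>D\<close>.\<close>
    then obtain r where r: "root p (u p) < r" "r < y" using dense by blast
    have root0: "root p (u p) \<ge> 0" by (rule real_root_ge_zero[OF nn])
    then have r0: "r > 0" using r by simp
    have up: "u p \<le> r ^ p"
    proof -
      have "u p = root p (u p) ^ p" using p nn by simp
      also have "\<dots> \<le> r ^ p" by (rule power_mono) (use r root0 in auto)
      finally show ?thesis .
    qed
    \<comment> \<open>\<open>D\<close> settles the remainders \<open>s < p\<close>; the induction
      then splits off \<open>p\<close> indices at a time, each time gaining a factor
      \<open>r ^ p\<close>.\<close>
    define D where "D = (\<Sum>s<p. u s / r ^ s)"
    have "u n \<le> D * r ^ n" for n
    proof (induction n rule: less_induct)
      case (less n)
      show ?case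
      proof (cases "n < p")
        case True
        then have "u n / r ^ n \<le> D" unfolding D_def
          by (intro member_le_sum) (use nn r0 in auto)
        then show ?thesis using r0 by (simp add: field_simps)
      next
        case False
        have "u n \<le> u p * u (n - p)" using sub[of p "n - p"] False by simp
        also have "\<dots> \<le> r ^ p * (D * r ^ (n - p))"
          by (intro mult_mono up less) (use False p r0 nn in auto)
        also have "\<dots> = D * (r ^ p * r ^ (n - p))" by simp
        also have "\<dots> = D * r ^ n" using False by (simp flip: power_add)
        finally show ?thesis .
      qed
    qed
    then show "\<forall>\<^sub>F n in sequentially. root n (u n) < y"
      by (rule eventually_root_less[OF _ r0 r(2)])
  qed
  then show ?thesis by (rule convergentI)
qed

text \<open>The bound must cover small indices too, since the index \<open>k \<le> n\<close>
  supplied by the upper comparison may be small while \<open>n\<close> is large. Finitely many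
  initial values are absorbed into \<open>D\<close>.\<close>

lemma root_tendsto_one_imp_bound:
  fixes u :: "nat \<Rightarrow> real"
  assumes "\<And>n. u n \<ge> 0" "(\<lambda>n. root n (u n)) \<longlonglongrightarrow> 1" "r > 1"
  shows "\<exists>D>0. \<forall>n. u n \<le> D * r ^ n"
proof -
  have "\<forall>\<^sub>F n in sequentially. root n (u n) < r \<and> n > 0"
    using order_tendstoD(2)[OF assms(2,3)] eventually_gt_at_top[of "0::nat"]
    by (rule eventually_conj)
  then obtain k where k: "\<And>n. n \<ge> k \<Longrightarrow> root n (u n) < r \<and> n > 0"
    unfolding eventually_sequentially by blast
  define D where "D = 1 + (\<Sum>i<k. u i)"
  have D1: "D \<ge> 1" unfolding D_def using assms(1) by (simp add: sum_nonneg)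
  have "u n \<le> D * r ^ n" for n
  proof (cases "n < k")
    case True
    then have "u n \<le> D" unfolding D_def
      using member_le_sum[of n "{..<k}" u] assms(1) by simp
    also have "\<dots> \<le> D * r ^ n" using D1 assms(3) by simp
    finally show ?thesis .
  next
    case False
    then have n: "root n (u n) < r" "n > 0" using k by auto
    have "u n = root n (u n) ^ n" using n assms(1) by simp
    also have "\<dots> \<le> r ^ n" by (rule power_mono) (use n assms(1) in auto)
    also have "\<dots> \<le> D * r ^ n" using D1 assms(3) by simp
    finally show ?thesis .
  qed
  then show ?thesis using D1 by (intro exI[of _ D]) auto
qed

section \<open>Blocks of products\<close>

definition block :: "real^('k::finite \<times> 'd::finite)^('k \<times> 'd) \<Rightarrow> 'k \<Rightarrow> 'k \<Rightarrow> real^'d^'d" where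
  "block X i j = (\<chi> a b. X $ (i, a) $ (j, b))"

lemma block_block_matrix_mult:
  "block (block_matrix M ** X) i j = (\<Sum>h\<in>UNIV. M i h ** block X h j)"
proof -
  have "(block (block_matrix M ** X) i j) $ a $ b = (\<Sum>h\<in>UNIV. M i h ** block X h j) $ a $ b"
    for a b
  proof -
    have "(block (block_matrix M ** X) i j) $ a $ b =
        (\<Sum>q\<in>UNIV \<times> UNIV. M i (fst q) $ a $ snd q * X $ q $ (j, b))"
      by (simp add: block_def matrix_matrix_mult_def block_matrix_def)
    also have "\<dots> = (\<Sum>h\<in>UNIV. \<Sum>c\<in>UNIV. M i h $ a $ c * X $ (h, c) $ (j, b))"
      by (simp add: sum.cartesian_product case_prod_unfold)
    finally show ?thesis
      by (simp add: matrix_matrix_mult_def block_def sum_component)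
  qed
  then show ?thesis by (simp add: vec_eq_iff)
qed

lemma block_mat_1: "block (mat 1) i j = (if i = j then mat 1 else 0)"
  by (auto simp: block_def mat_def vec_eq_iff)

lemma block_diagonal_mult_block:
  "block (block_diagonal e A ** X) i j = A (e i) ** block X i j"
proof -
  have "block (block_diagonal e A ** X) i j =
      (\<Sum>h\<in>UNIV. if i = h then A (e i) ** block X h j else 0)"
    unfolding block_diagonal_def block_block_matrix_mult
    by (intro sum.cong) auto
  then show ?thesis by simp
qed

text \<open>Block row \<open>i\<close> of the shift has a single identity block, in the column of
  the cyclic predecessor \<open>i'\<close>, so left multiplication only permutes block rows.\<close>

lemma shift_matrix_mult_block:
  assumes "bij_betw e UNIV {0..<m}" "e i = (e i' + 1) mod m"
  shows "block (shift_matrix m e ** X) i j = block X i' j"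
proof -
  have lt: "e h < m" for h using assms(1) by (auto simp: bij_betw_def)
  have "e i mod m = (e h + 1) mod m \<longleftrightarrow> i' = h" for h
  proof
    assume "e i mod m = (e h + 1) mod m"
    then have "(e i' + 1) mod m = (e h + 1) mod m" using assms(2) by simp
    then have "e i' = e h" using lt[of i'] lt[of h] by (auto simp: mod_Suc split: if_splits)
    then show "i' = h" using assms(1) by (auto simp: bij_betw_def inj_on_def)
  qed (use assms(2) in auto)
  then have "block (shift_matrix m e ** X) i j =
      (\<Sum>h\<in>UNIV. if i' = h then block X h j else 0)"
    unfolding shift_matrix_def block_block_matrix_mult by (intro sum.cong) auto
  then show ?thesis by simp
qed

lemma ex_index:
  fixes e :: "'k \<Rightarrow> nat"
  assumes "bij_betw e UNIV {0..<m}" "l < m"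
  shows "\<exists>i. e i = l"
proof -
  have "l \<in> range e" using assms by (simp add: bij_betw_def)
  then show ?thesis by auto
qed

text \<open>Induction on the leftmost factor: a shift permutes block rows and keeps
  \<open>k\<close>, while the block diagonal factor puts one more \<open>A (e i)\<close> in front of
  every block. Hence one \<open>k\<close> serves all blocks.\<close>

lemma blocks_of_products:
  fixes A :: "nat \<Rightarrow> real^'d^'d"
  assumes bij: "bij_betw e UNIV {0..<m}"
    and "X \<in> products {shift_matrix m e, block_diagonal e A} n"
  shows "\<exists>k\<le>n. \<forall>i j. block X i j = 0 \<or> block X i j \<in> products (A ` {0..<m}) k"
  using assms(2)
proof (induction n arbitrary: X)
  case 0
  then show ?case by (auto simp: products_0 block_mat_1)
next
  case (Suc n)
  let ?S = "shift_matrix m e" and ?D = "block_diagonal e A"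
  obtain Y X' where X: "Y = ?S \<or> Y = ?D" "X' \<in> products {?S, ?D} n" "X = Y ** X'"
    using Suc.prems unfolding products_Suc by blast
  obtain k where k: "k \<le> n"
    "\<And>i j. block X' i j = 0 \<or> block X' i j \<in> products (A ` {0..<m}) k"
    using Suc.IH[OF X(2)] by blast
  have lt: "e h < m" for h using bij by (auto simp: bij_betw_def)
  show ?case
  \<comment> \<open>Should the two generators coincide, the factor is counted as a shift.\<close>
  proof (cases "Y = ?S")
    case True
    have "\<exists>i'. e i = (e i' + 1) mod m" for i
    proof -
      \<comment> \<open>Adding \<open>m - 1\<close> subtracts one modulo \<open>m\<close> within the
        naturals.\<close>
      have "(e i + (m - 1)) mod m < m" using lt[of i] by simp
      then obtain i' where i': "e i' = (e i + (m - 1)) mod m" using ex_index[OF bij] by blast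
      have "(e i' + 1) mod m = (e i + (m - 1) + 1) mod m" unfolding i' by (rule mod_add_left_eq)
      also have "\<dots> = e i" using lt[of i] by simp
      finally show ?thesis by metis
    qed
    then have "\<exists>i'. \<forall>j. block X i j = block X' i' j" for i
      using shift_matrix_mult_block[OF bij] X(3) True by metis
    then show ?thesis using k by (intro exI[of _ k]) (metis le_SucI)
  next
    case False
    then have "block X i j = A (e i) ** block X' i j" for i j
      using X by (simp add: block_diagonal_mult_block)
    moreover have "A (e i) \<in> A ` {0..<m}" for i using lt by auto
    moreover have "Z ** (0 :: real^'d^'d) = 0" for Z :: "real^'d^'d"
      by (simp add: matrix_matrix_mult_def vec_eq_iff)
    ultimately have "block X i j = 0 \<or> block X i j \<in> products (A ` {0..<m}) (Suc k)" for i j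
      using k(2)[of i j] unfolding products_Suc by (metis (mono_tags, lifting) mem_Collect_eq)
    then show ?thesis using k(1) by (intro exI[of _ "Suc k"]) auto
  qed
qed

lemma shift_block_row:
  assumes bij: "bij_betw e UNIV {0..<m}" and "shift_matrix m e \<in> S"
    and "X \<in> products S n" "e i = (e i' + c) mod m"
  shows "\<exists>X'\<in>products S (c + n). \<forall>j. block X' i j = block X i' j"
  using assms(4)
proof (induction c arbitrary: i)
  case 0
  have "e i' < m" using bij by (auto simp: bij_betw_def)
  then have "i = i'" using 0 bij by (auto simp: bij_betw_def inj_on_def)
  then show ?case using assms(3) by auto
next
  case (Suc c)
  have "e i < m" using bij by (auto simp: bij_betw_def)
  then have "(e i' + c) mod m < m" by simp
  then obtain h where h: "e h = (e i' + c) mod m" using ex_index[OF bij] by blast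
  then obtain X' where X': "X' \<in> products S (c + n)" "\<And>j. block X' h j = block X i' j"
    using Suc.IH by blast
  have "e i = (e h + 1) mod m" unfolding h using Suc.prems by (simp add: mod_Suc_eq)
  then have "block (shift_matrix m e ** X') i j = block X i' j" for j
    using shift_matrix_mult_block[OF bij] X'(2) by metis
  moreover have "shift_matrix m e ** X' \<in> products S (Suc c + n)"
    using X'(1) assms(2) by (auto simp: products_Suc)
  ultimately show ?case by blast
qed

text \<open>Each factor \<open>A l\<close> costs one block diagonal factor and at most
  \<open>m - 1\<close> shifts, hence at most \<open>m\<close> factors. The row \<open>i\<close> is
  arbitrary because the induction needs the shorter product in the row numbered \<open>l\<close>;
  surplus length ends up as shifts in the base case.\<close>

lemma product_occurs_as_block:
  fixes e :: "'k::finite \<Rightarrow> nat" and A :: "nat \<Rightarrow> real^'d^'d" and m :: nat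
  defines "S \<equiv> {shift_matrix m e, block_diagonal e A}"
  assumes bij: "bij_betw e UNIV {0..<m}"
    and "Y \<in> products (A ` {0..<m}) k" "m * k \<le> n"
  shows "\<exists>X\<in>products S n. \<exists>j. block X i j = Y"
  using assms(3,4)
proof (induction k arbitrary: Y n i)
  case 0
  have lt: "e i < m" using bij by (auto simp: bij_betw_def)
  \<comment> \<open>\<open>i'\<close> is the row that \<open>n\<close> shifts carry to
    \<open>i\<close>; the term \<open>m * n\<close> keeps the subtraction of \<open>n\<close>
    exact.\<close>
  obtain i' where i': "e i' = (e i + m * n - n) mod m"
    using ex_index[OF bij, of "(e i + m * n - n) mod m"] lt by auto
  have "n \<le> m * n" using lt by simp
  then have "e i + m * n - n + n = e i + m * n" by linarith
  then have "(e i' + n) mod m = (e i + m * n) mod m"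
    unfolding i' by (metis mod_add_left_eq)
  then have "e i = (e i' + n) mod m" using lt by simp
  then obtain X where "X \<in> products S (n + 0)" "\<And>j. block X i j = block (mat 1) i' j"
    using shift_block_row[OF bij, of S "mat 1" 0 i i' n] unfolding S_def
    by (auto simp: products_0)
  moreover have "Y = mat 1" using 0 by (simp add: products_0)
  ultimately show ?case by (intro bexI[of _ X] exI[of _ i']) (auto simp: block_mat_1)
next
  case (Suc k)
  then obtain l Y' where Y: "l < m" "Y' \<in> products (A ` {0..<m}) k" "Y = A l ** Y'"
    by (auto simp: products_Suc)
  obtain h where h: "e h = l" using ex_index[OF bij Y(1)] by blast
  have lt: "e i < m" using bij by (auto simp: bij_betw_def)
  \<comment> \<open>The number of shifts that carry row \<open>l\<close> to row \<open>e i\<close>.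
    As \<open>c < m\<close>, at least \<open>m * k\<close> factors remain for
    \<open>Y'\<close>.\<close>
  define c where "c = (e i + (m - l)) mod m"
  have "c < m" using lt unfolding c_def by simp
  then have n: "m * k \<le> n - c - 1" "c + Suc (n - c - 1) = n" using Suc.prems(2) by auto
  have "(l + c) mod m = (l + (e i + (m - l))) mod m"
    unfolding c_def by (rule mod_add_right_eq)
  also have "\<dots> = e i" using Y(1) lt by simp
  finally have ei: "e i = (e h + c) mod m" using h by simp
  obtain X' j where X': "X' \<in> products S (n - c - 1)" "block X' h j = Y'"
    using Suc.IH[OF Y(2) n(1)] by blast
  have "block (block_diagonal e A ** X') h j = Y"
    by (simp add: block_diagonal_mult_block h X' Y)
  moreover have "block_diagonal e A ** X' \<in> products S (Suc (n - c - 1))"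
    using X'(1) unfolding S_def by (auto simp: products_Suc)
  then have "\<exists>X\<in>products S (c + Suc (n - c - 1)).
      \<forall>j. block X i j = block (block_diagonal e A ** X') h j"
    by (intro shift_block_row[OF bij _ _ ei]) (simp_all add: S_def)
  ultimately show ?case unfolding n(2) by metis
qed

section \<open>Comparison of the marginal rates\<close>

text \<open>Every entry of a maximizing product lies in a block that is zero or a product of the
  common length \<open>k\<close>; norm equivalence does the rest with a constant independent of
  \<open>n\<close>.\<close>

lemma marginal_rate_block_upper:
  fixes A :: "nat \<Rightarrow> real^'d^'d" and e :: "'k::finite \<Rightarrow> nat"
  assumes bij: "bij_betw e UNIV {0..<m}" and N: "is_norm N" and N': "is_norm N'"
  shows "\<exists>C>0. \<forall>n. \<exists>k\<le>n. marginal_rate N' {shift_matrix m e, block_diagonal e A} n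
    \<le> C * marginal_rate N (A ` {0..<m}) k"
proof -
  let ?A = "A ` {0..<m}" and ?B = "{shift_matrix m e, block_diagonal e A}"
  obtain C where C: "C > 0" "\<And>X. N' X \<le> C * norm X" using is_norm_le_norm[OF N'] by blast
  obtain D where D: "D > 0" "\<And>X. norm X \<le> D * N X" using norm_le_is_norm[OF N] by blast
  define p where "p = real CARD('k \<times> 'd)"
  have p: "p > 0" unfolding p_def by simp
  have "m > 0" using bij by (auto simp: bij_betw_def intro: ccontr)
  then have fin: "finite ?A" "?A \<noteq> {}" by auto
  have "\<exists>k\<le>n. marginal_rate N' ?B n \<le> (C * p * p * D) * marginal_rate N ?A k" for n
  proof -
    obtain X where X: "X \<in> products ?B n" "marginal_rate N' ?B n = N' X"
      using marginal_rate_attained[of ?B n N'] by auto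
    obtain k where k: "k \<le> n" "\<And>i j. block X i j = 0 \<or> block X i j \<in> products ?A k"
      using blocks_of_products[OF bij X(1)] by blast
    have nb: "norm (block X i j) \<le> D * marginal_rate N ?A k" for i j
    proof (cases "block X i j = 0")
      case True
      then show ?thesis using D(1) marginal_rate_nonneg[OF fin N, of k] by simp
    next
      case False
      then have "N (block X i j) \<le> marginal_rate N ?A k"
        using k(2) marginal_rate_upper[OF fin(1)] by blast
      then show ?thesis
        using le_mult_trans[OF D(2)] D(1) by simp
    qed
    have "\<bar>X $ q $ r\<bar> \<le> D * marginal_rate N ?A k" for q r
    proof -
      have "X $ q $ r = block X (fst q) (fst r) $ snd q $ snd r" by (simp add: block_def)
      then show ?thesis using matrix_entry_le_norm nb by (metis order_trans)
    qed
    then have "norm X \<le> p * (p * (D * marginal_rate N ?A k))"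
      unfolding p_def by (rule norm_matrix_le)
    then have "N' X \<le> C * (p * (p * (D * marginal_rate N ?A k)))"
      using le_mult_trans[OF C(2)] C(1) by simp
    then show ?thesis using k(1) X(2) by (auto simp: mult.assoc)
  qed
  then show ?thesis using C(1) D(1) p by (intro exI[of _ "C * p * p * D"]) auto
qed

text \<open>A maximizing product of length \<open>k\<close> is a block of some product of length
  \<open>n\<close>, so its entries are among the entries of that product. The case
  \<open>k = 0\<close> bounds the rate from below by a constant.\<close>

lemma marginal_rate_block_lower:
  fixes A :: "nat \<Rightarrow> real^'d^'d" and e :: "'k::finite \<Rightarrow> nat"
  assumes bij: "bij_betw e UNIV {0..<m}" and N: "is_norm N" and N': "is_norm N'"
  shows "\<exists>c>0. \<forall>k n. m * k \<le> n \<longrightarrow> c * marginal_rate N (A ` {0..<m}) k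
    \<le> marginal_rate N' {shift_matrix m e, block_diagonal e A} n"
proof -
  let ?A = "A ` {0..<m}" and ?B = "{shift_matrix m e, block_diagonal e A}"
  obtain C where C: "C > 0" "\<And>X. N X \<le> C * norm X" using is_norm_le_norm[OF N] by blast
  obtain D where D: "D > 0" "\<And>X. norm X \<le> D * N' X" using norm_le_is_norm[OF N'] by blast
  define p where "p = real CARD('d)"
  have p: "p > 0" unfolding p_def by simp
  have "m > 0" using bij by (auto simp: bij_betw_def intro: ccontr)
  then have fin: "finite ?A" "?A \<noteq> {}" by auto
  have "marginal_rate N ?A k \<le> (C * p * p * D) * marginal_rate N' ?B n" if kn: "m * k \<le> n" for k n
  proof -
    obtain Y where Y: "Y \<in> products ?A k" "marginal_rate N ?A k = N Y"
      using marginal_rate_attained[OF fin] by blast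
    obtain X i j where X: "X \<in> products ?B n" "block X i j = Y"
      using product_occurs_as_block[OF bij Y(1) kn] by blast
    have "\<bar>Y $ q $ r\<bar> \<le> norm X" for q r
      using matrix_entry_le_norm[of X "(i, q)" "(j, r)"] X(2) by (auto simp: block_def)
    then have "norm Y \<le> p * (p * norm X)" unfolding p_def by (rule norm_matrix_le)
    also have "\<dots> \<le> p * (p * (D * marginal_rate N' ?B n))"
      using le_mult_trans[OF D(2) marginal_rate_upper[OF _ X(1)]] D(1) p
      by (intro mult_left_mono) auto
    finally have "N Y \<le> C * (p * (p * (D * marginal_rate N' ?B n)))"
      using le_mult_trans[OF C(2)] C(1) by simp
    then show ?thesis using Y(2) by (simp add: mult.assoc)
  qed
  moreover have "C * p * p * D > 0" using C(1) D(1) p by simp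
  ultimately show ?thesis
    by (intro exI[of _ "1 / (C * p * p * D)"]) (auto simp: field_simps)
qed

text \<open>Upper bound: \<open>a k\<close> is at most a multiple of \<open>\<gamma> k\<close>,
  hence of \<open>\<gamma> n\<close>, as \<open>k \<le> n\<close>. Lower bound: \<open>n\<close> is
  at most a fixed multiple of some \<open>\<nu> l\<close> with \<open>m * \<nu> l \<le> n\<close>,
  so \<open>\<gamma> n\<close> is controlled by \<open>\<gamma> (\<nu> l)\<close>, then by
  \<open>a (\<nu> l)\<close>, then by \<open>b n\<close>.\<close>

lemma rate_simeq:
  fixes a b \<gamma> :: "nat \<Rightarrow> real" and \<nu> :: "nat \<Rightarrow> nat"
  assumes m: "m \<ge> 1" and a0: "a 0 > 0"
    and U: "C > 0" "\<And>n. \<exists>k\<le>n. b n \<le> C * a k"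
    and L: "c > 0" "\<And>k n. m * k \<le> n \<Longrightarrow> c * a k \<le> b n"
    and \<gamma>pos: "\<And>n. n \<ge> 1 \<Longrightarrow> \<gamma> n > 0"
    and inc: "weakly_increasing \<gamma>" and reg: "weakly_upper_regularly_varying \<gamma>"
    and \<nu>1: "\<And>l. l \<ge> 1 \<Longrightarrow> \<nu> l \<ge> 1" and \<nu>mono: "strict_mono_on {1..} \<nu>"
    and K: "\<And>l. l \<ge> 1 \<Longrightarrow> real (\<nu> (l + 1)) / real (\<nu> l) \<le> K"
    and a\<gamma>: "a \<lesssim> \<gamma>" and \<gamma>a: "(\<lambda>l. \<gamma> (\<nu> l)) \<lesssim> (\<lambda>l. a (\<nu> l))"
  shows "b \<simeq> \<gamma>"
proof -
  obtain \<kappa>' where \<kappa>': "\<kappa>' > 0" "\<And>n k. n \<ge> 1 \<Longrightarrow> k \<ge> 1 \<Longrightarrow> \<gamma> (n + k) \<ge> \<kappa>' * \<gamma> n"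
    using inc unfolding weakly_increasing_def by blast
  \<comment> \<open>The cap at 1 admits \<open>j = n\<close>, since weak monotonicity only speaks of
    strictly larger indices.\<close>
  define \<kappa> where "\<kappa> = min \<kappa>' 1"
  have \<kappa>0: "\<kappa> > 0" using \<kappa>'(1) unfolding \<kappa>_def by simp
  have \<kappa>: "\<kappa> * \<gamma> j \<le> \<gamma> n" if "1 \<le> j" "j \<le> n" for j n
  proof (cases "j = n")
    case True
    then show ?thesis using mult_right_mono[of \<kappa> 1 "\<gamma> j"] \<gamma>pos[OF that(1)]
      unfolding \<kappa>_def by simp
  next
    case False
    have "\<kappa> * \<gamma> j \<le> \<kappa>' * \<gamma> j" using \<gamma>pos[OF that(1)] unfolding \<kappa>_def by simp
    also have "\<dots> \<le> \<gamma> (j + (n - j))" by (rule \<kappa>') (use that False in auto)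
    finally show ?thesis using that by simp
  qed
  obtain E where E: "E > 0" "\<And>n. n \<ge> 1 \<Longrightarrow> a n \<le> E * \<gamma> n"
    using a\<gamma> unfolding lesssim_def by blast
  obtain F where F: "F > 0" "\<And>l. l \<ge> 1 \<Longrightarrow> \<gamma> (\<nu> l) \<le> F * a (\<nu> l)"
    using \<gamma>a unfolding lesssim_def by blast
  have \<gamma>1: "\<gamma> 1 > 0" by (rule \<gamma>pos) simp
  have "b \<lesssim> \<gamma>"
  proof -
    \<comment> \<open>The second entry handles \<open>k = 0\<close>, about which
      \<open>a \<lesssim> \<gamma>\<close> says nothing.\<close>
    define E' where "E' = max E (a 0 / \<gamma> 1)"
    have E'0: "E' > 0" using E(1) unfolding E'_def by simp
    have "b n \<le> (C * (E' / \<kappa>)) * \<gamma> n" if n: "n \<ge> 1" for n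
    proof -
      obtain k where k: "k \<le> n" "b n \<le> C * a k" using U(2) by blast
      have "\<exists>j\<in>{1..n}. a k \<le> E' * \<gamma> j"
      proof (cases "k = 0")
        case True
        have "a 0 = (a 0 / \<gamma> 1) * \<gamma> 1" using \<gamma>1 by simp
        also have "\<dots> \<le> E' * \<gamma> 1" unfolding E'_def using \<gamma>1 by (intro mult_right_mono) auto
        finally show ?thesis using True n by (intro bexI[of _ 1]) auto
      next
        case False
        then have "a k \<le> E * \<gamma> k" using E(2) by simp
        also have "\<dots> \<le> E' * \<gamma> k" unfolding E'_def using \<gamma>pos[of k] False
          by (intro mult_right_mono) auto
        finally show ?thesis using False k by (intro bexI[of _ k]) auto
      qed
      then obtain j where j: "1 \<le> j" "j \<le> n" "a k \<le> E' * \<gamma> j" by auto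
      have "E' * \<gamma> j \<le> E' * (\<gamma> n / \<kappa>)"
        using \<kappa>[OF j(1,2)] \<kappa>0 E'0 by (intro mult_left_mono) (auto simp: field_simps)
      then have "C * a k \<le> C * (E' * (\<gamma> n / \<kappa>))"
        using j(3) U(1) by (intro mult_left_mono) auto
      then show ?thesis using k(2) by simp
    qed
    then show ?thesis unfolding lesssim_def
      using U(1) E'0 \<kappa>0 by (intro exI[of _ "C * (E' / \<kappa>)"]) auto
  qed
  moreover have "\<gamma> \<lesssim> b"
  proof -
    \<comment> \<open>Regular variation takes integer factors, so \<open>K\<close> is rounded up;
      \<open>m\<close> accounts for the length lost in the lower comparison.\<close>
    define Q where "Q = nat \<lceil>K\<rceil> * m"
    have step: "\<nu> (Suc l) \<le> nat \<lceil>K\<rceil> * \<nu> l" if "l \<ge> 1" for l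
    proof -
      have "real (\<nu> (Suc l)) \<le> K * real (\<nu> l)"
        using K[OF that] \<nu>1[OF that] by (simp add: field_simps)
      also have "\<dots> \<le> real (nat \<lceil>K\<rceil>) * real (\<nu> l)"
        by (intro mult_right_mono) (auto simp: real_nat_ceiling_ge)
      finally show ?thesis by (simp flip: of_nat_mult)
    qed
    have \<nu>less: "\<nu> l < \<nu> (Suc l)" if "l \<ge> 1" for l
      using \<nu>mono that by (auto simp: strict_mono_on_def)
    have "nat \<lceil>K\<rceil> \<ge> 1" using step[of 1] \<nu>1[of 2] by (cases "nat \<lceil>K\<rceil>") (auto simp: numeral_2_eq_2)
    then have Q1: "Q \<ge> 1" using m unfolding Q_def by simp
    obtain G where G: "G > 0" "\<And>n. n \<ge> 1 \<Longrightarrow> \<gamma> (n * Q) \<le> G * \<gamma> n"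
      using reg Q1 unfolding weakly_upper_regularly_varying_def by blast
    have \<nu>ge: "l \<le> \<nu> l" if "l \<ge> 1" for l
      using that
    proof (induction l rule: nat_induct_at_least)
      case base
      then show ?case using \<nu>1 by simp
    next
      case (Suc l)
      then show ?case using \<nu>less[of l] by simp
    qed
    \<comment> \<open>Covers the indices too small for any \<open>\<nu> l\<close>, using
      \<open>b n \<ge> c * a 0\<close>. The absolute values are there because the sum includes
      \<open>\<gamma> 0\<close>, whose sign is unknown.\<close>
    define H where "H = (\<Sum>n<m * \<nu> 1. \<bar>\<gamma> n\<bar>) / (c * a 0)"
    have H0: "H \<ge> 0" unfolding H_def using L(1) a0 by (simp add: sum_nonneg)
    define T where "T = G * F / (\<kappa> * c)"
    have T0: "T > 0" unfolding T_def using G F \<kappa>0 L by simp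
    have "\<gamma> n \<le> (T + H) * b n" if n: "n \<ge> 1" for n
    proof -
      have bn: "c * a 0 \<le> b n" using L(2)[of 0 n] by simp
      have b0: "b n > 0" using bn mult_pos_pos[OF L(1) a0] by linarith
      have "\<gamma> n \<le> T * b n \<or> \<gamma> n \<le> H * b n"
      proof (cases "n < m * \<nu> 1")
        case True
        then have "\<gamma> n \<le> (\<Sum>n<m * \<nu> 1. \<bar>\<gamma> n\<bar>)"
          using member_le_sum[of n "{..<m * \<nu> 1}" "\<lambda>n. \<bar>\<gamma> n\<bar>"] by fastforce
        also have "\<dots> = H * (c * a 0)" unfolding H_def using L(1) a0 by simp
        also have "\<dots> \<le> H * b n" by (rule mult_left_mono[OF bn H0])
        finally show ?thesis ..
      next
        case False
        \<comment> \<open>Maximality gives \<open>n < m * \<nu> (Suc l)\<close>, and the bounded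
          ratio turns this into \<open>n \<le> \<nu> l * Q\<close>.\<close>
        define l where "l = Max {l. 1 \<le> l \<and> m * \<nu> l \<le> n}"
        have fin: "finite {l. 1 \<le> l \<and> m * \<nu> l \<le> n}"
        proof (rule finite_subset)
          show "{l. 1 \<le> l \<and> m * \<nu> l \<le> n} \<subseteq> {..n}"
          proof
            fix l assume "l \<in> {l. 1 \<le> l \<and> m * \<nu> l \<le> n}"
            then have "l \<le> \<nu> l" "m * \<nu> l \<le> n" using \<nu>ge by auto
            moreover have "1 * \<nu> l \<le> m * \<nu> l" using m by (rule mult_right_mono) simp
            ultimately show "l \<in> {..n}" unfolding mult_1 atMost_iff by linarith
          qed
        qed simp
        have "l \<in> {l. 1 \<le> l \<and> m * \<nu> l \<le> n}" unfolding l_def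
          by (rule Max_in[OF fin]) (use False in force)
        then have l: "1 \<le> l" "m * \<nu> l \<le> n" by auto
        have "Suc l \<notin> {l. 1 \<le> l \<and> m * \<nu> l \<le> n}"
          using Max_ge[OF fin, of "Suc l"] unfolding l_def by fastforce
        then have "n < m * \<nu> (Suc l)" by auto
        also have "\<dots> \<le> m * (nat \<lceil>K\<rceil> * \<nu> l)" using step[OF l(1)] by simp
        finally have "n \<le> \<nu> l * Q" unfolding Q_def by (simp add: ac_simps)
        then have "\<kappa> * \<gamma> n \<le> \<gamma> (\<nu> l * Q)" using \<kappa> n by blast
        also have "\<dots> \<le> G * \<gamma> (\<nu> l)" using G(2) \<nu>1[OF l(1)] by blast
        also have "\<dots> \<le> G * (F * a (\<nu> l))" using F(2)[OF l(1)] G(1) by simp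
        also have "\<dots> \<le> G * (F * (b n / c))"
          using L(2)[OF l(2)] L(1) G(1) F(1)
          by (intro mult_left_mono) (auto simp: field_simps)
        finally have "\<gamma> n \<le> T * b n"
          unfolding T_def using \<kappa>0 L(1) by (simp add: field_simps)
        then show ?thesis ..
      qed
      then show ?thesis
        using mult_nonneg_nonneg[OF H0, of "b n"] mult_pos_pos[OF T0 b0] b0
        by (auto simp: algebra_simps)
    qed
    then show ?thesis unfolding lesssim_def using T0 H0 by (intro exI[of _ "T + H"]) auto
  qed
  ultimately show ?thesis unfolding simeq_def by blast
qed

section \<open>Spectral radius of the block pair, and (b) as an instance of (a)\<close>

theorem theorem2:
  fixes m :: nat
    and A :: "nat \<Rightarrow> real^'d^'d"
    and e :: "'k::finite \<Rightarrow> nat"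
    and B0 B1 :: "real^('k \<times> 'd)^('k \<times> 'd)"
  assumes "m \<ge> 1"
    and "bij_betw e UNIV {0..<m}"
    and "joint_spectral_radius (A ` {0..<m}) = 1"
    and "B0 = shift_matrix m e"
    and "B1 = block_diagonal e A"
  shows "joint_spectral_radius {B0, B1} = 1 \<and>
    (\<forall>N N'. is_norm N \<and> is_norm N' \<longrightarrow>
      (let a = marginal_rate N (A ` {0..<m});
           b = marginal_rate N' {B0, B1}
       in
         (\<forall>(\<gamma> :: nat \<Rightarrow> real) (\<nu> :: nat \<Rightarrow> nat).
            (\<forall>n\<ge>1. \<gamma> n > 0) \<and>
            weakly_increasing \<gamma> \<and>
            weakly_upper_regularly_varying \<gamma> \<and>
            (\<forall>l\<ge>1. \<nu> l \<ge> 1) \<and>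
            strict_mono_on {1..} \<nu> \<and>
            (\<exists>K. \<forall>l\<ge>1. real (\<nu> (l + 1)) / real (\<nu> l) \<le> K) \<and>
            a \<lesssim> \<gamma> \<and>
            (\<lambda>l. \<gamma> (\<nu> l)) \<lesssim> (\<lambda>l. a (\<nu> l))
            \<longrightarrow> b \<simeq> \<gamma>) \<and>
         (weakly_increasing a \<and> weakly_upper_regularly_varying a
            \<longrightarrow> b \<simeq> a)))"
  (is "?thesis1 \<and> _")
proof -
  let ?A = "A ` {0..<m}" and ?B = "{B0, B1}"
  let ?o = "\<lambda>X :: real^'d^'d. onorm ((*v) X)"
  let ?o' = "\<lambda>X :: real^('k \<times> 'd)^('k \<times> 'd). onorm ((*v) X)"
  define u where "u = marginal_rate ?o ?A"
  define v where "v = marginal_rate ?o' ?B"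
  note bij = assms(2) and B = assms(4,5)
  have fin: "finite ?A" "?A \<noteq> {}" using assms(1) by auto
  have u_nn: "u n \<ge> 0" for n
    unfolding u_def by (rule marginal_rate_nonneg[OF fin is_norm_onorm])
  have u_sub: "u (n + k) \<le> u n * u k" for n k
    unfolding u_def by (rule marginal_rate_onorm_submult[OF fin])
  have "lim (\<lambda>n. root n (u n)) = 1"
    using assms(3) joint_spectral_radius_eq_lim[OF fin] by (simp add: u_def)
  \<comment> \<open>An equation for \<open>lim\<close> yields convergence only once a limit is known
    to exist, which Fekete's lemma provides.\<close>
  then have u_lim: "(\<lambda>n. root n (u n)) \<longlonglongrightarrow> 1"
    using fekete_root_convergent[OF u_nn u_sub] by (metis convergent_LIMSEQ_iff)
  \<comment> \<open>A single zero would spread to all later indices by submultiplicativity and force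
    the limit 0.\<close>
  have u_pos: "u n > 0" for n
  proof (rule ccontr)
    assume "\<not> u n > 0"
    then have un: "u n = 0" using u_nn[of n] by simp
    have "root k (u k) = 0" if "k \<ge> n" for k
      using u_sub[of n "k - n"] u_nn[of k] un that by simp
    then have "\<forall>\<^sub>F k in sequentially. root k (u k) = 0"
      unfolding eventually_sequentially by blast
    then have "(\<lambda>k. root k (u k)) \<longlonglongrightarrow> 0" by (rule tendsto_eventually)
    with u_lim show False using LIMSEQ_unique by fastforce
  qed
  have part1: ?thesis1
  proof -
    obtain C where C: "C > 0" "\<And>n. \<exists>k\<le>n. v n \<le> C * u k"
      using marginal_rate_block_upper[OF bij is_norm_onorm is_norm_onorm, of A]
      unfolding u_def v_def B by blast
    obtain c where c: "c > 0" "\<And>k n. m * k \<le> n \<Longrightarrow> c * u k \<le> v n"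
      using marginal_rate_block_lower[OF bij is_norm_onorm is_norm_onorm, of A]
      unfolding u_def v_def B by blast
    have "(\<lambda>n. root n (v n)) \<longlonglongrightarrow> 1"
    proof (rule order_tendstoI)
      fix y :: real assume y: "y < 1"
      \<comment> \<open>The lower comparison with \<open>k = 0\<close> already suffices:
        \<open>v\<close> stays above a positive constant.\<close>
      have "(\<lambda>n. root n (c * u 0)) \<longlonglongrightarrow> 1" using c(1) u_pos[of 0] by (intro LIMSEQ_root_const) simp
      then have "\<forall>\<^sub>F n in sequentially. y < root n (c * u 0)" using y by (rule order_tendstoD)
      with eventually_gt_at_top[of "0::nat"] show "\<forall>\<^sub>F n in sequentially. y < root n (v n)"
      proof eventually_elim
        case (elim n)
        have "root n (c * u 0) \<le> root n (v n)" using elim c(2)[of 0 n] by simp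
        with elim show ?case by linarith
      qed
    next
      fix y :: real assume "1 < y"
      then obtain r where r: "1 < r" "r < y" using dense by blast
      obtain D where D: "D > 0" "\<And>n. u n \<le> D * r ^ n"
        using root_tendsto_one_imp_bound[OF u_nn u_lim r(1)] by blast
      have "v n \<le> (C * D) * r ^ n" for n
      proof -
        obtain k where k: "k \<le> n" "v n \<le> C * u k" using C(2) by blast
        have "C * u k \<le> C * (D * r ^ k)" using D(2) C(1) by simp
        \<comment> \<open>\<open>r > 1\<close> makes the bound at the unknown index
          \<open>k \<le> n\<close> one at \<open>n\<close>.\<close>
        also have "\<dots> \<le> C * (D * r ^ n)"
          using k(1) r(1) C(1) D(1) by (simp add: power_increasing)
        finally show ?thesis using k(2) by simp
      qed
      then show "\<forall>\<^sub>F n in sequentially. root n (v n) < y"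
        by (rule eventually_root_less) (use r in auto)
    qed
    then show ?thesis using joint_spectral_radius_eq_lim[of ?B] by (simp add: limI v_def)
  qed
  have part2: "(\<forall>(\<gamma> :: nat \<Rightarrow> real) (\<nu> :: nat \<Rightarrow> nat).
            (\<forall>n\<ge>1. \<gamma> n > 0) \<and> weakly_increasing \<gamma> \<and> weakly_upper_regularly_varying \<gamma> \<and>
            (\<forall>l\<ge>1. \<nu> l \<ge> 1) \<and> strict_mono_on {1..} \<nu> \<and>
            (\<exists>K. \<forall>l\<ge>1. real (\<nu> (l + 1)) / real (\<nu> l) \<le> K) \<and>
            a \<lesssim> \<gamma> \<and> (\<lambda>l. \<gamma> (\<nu> l)) \<lesssim> (\<lambda>l. a (\<nu> l)) \<longrightarrow> b \<simeq> \<gamma>) \<and>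
         (weakly_increasing a \<and> weakly_upper_regularly_varying a \<longrightarrow> b \<simeq> a)"
    if N: "is_norm N" and N': "is_norm N'"
      and ab: "a = marginal_rate N ?A" "b = marginal_rate N' ?B" for N N' a b
  proof -
    obtain C where C: "C > 0" "\<And>n. \<exists>k\<le>n. b n \<le> C * a k"
      using marginal_rate_block_upper[OF bij N N', of A] unfolding ab B by blast
    obtain c where c: "c > 0" "\<And>k n. m * k \<le> n \<Longrightarrow> c * a k \<le> b n"
      using marginal_rate_block_lower[OF bij N N', of A] unfolding ab B by blast
    \<comment> \<open>Positivity passes from the operator norm to \<open>N\<close> by equivalence of
      norms.\<close>
    have a_pos: "a n > 0" for n
    proof -
      obtain D where D: "D > 0" "\<And>X. ?o X \<le> D * N X"
        using is_norm_equivalent[OF is_norm_onorm N] by blast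
      obtain X where "X \<in> products ?A n" "u n = ?o X"
        using marginal_rate_attained[OF fin, of n ?o] unfolding u_def by blast
      then have "u n \<le> D * a n"
        using le_mult_trans[OF D(2) marginal_rate_upper[OF fin(1)]] D(1) unfolding ab by simp
      then show ?thesis using u_pos[of n] D(1) by (metis less_le_trans zero_less_mult_pos)
    qed
    note key = rate_simeq[OF assms(1) a_pos C c]
    have refl: "a \<lesssim> a" unfolding lesssim_def by (intro exI[of _ 1]) simp
    have "b \<simeq> a" if "weakly_increasing a" "weakly_upper_regularly_varying a"
    \<comment> \<open>Part (b) is the case where \<open>\<gamma>\<close> is \<open>a\<close> itself
      and the subsequence is the whole sequence.\<close>
    proof (rule key[where \<nu> = "\<lambda>l. l" and K = 2])
      show "strict_mono_on {1..} (\<lambda>l::nat. l)" by (simp add: strict_mono_on_def)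
      show "real (l + 1) / real l \<le> 2" if "l \<ge> 1" for l using that by (simp add: field_simps)
    qed (use that a_pos refl in auto)
    moreover have "b \<simeq> \<gamma>"
      if h: "\<forall>n\<ge>1. \<gamma> n > 0" "weakly_increasing \<gamma>" "weakly_upper_regularly_varying \<gamma>"
        "\<forall>l\<ge>1. \<nu> l \<ge> 1" "strict_mono_on {1..} \<nu>"
        "\<exists>K. \<forall>l\<ge>1. real (\<nu> (l + 1)) / real (\<nu> l) \<le> K"
        "a \<lesssim> \<gamma>" "(\<lambda>l. \<gamma> (\<nu> l)) \<lesssim> (\<lambda>l. a (\<nu> l))" for \<gamma> \<nu>
    proof -
      obtain K where "\<forall>l\<ge>1. real (\<nu> (l + 1)) / real (\<nu> l) \<le> K"
        using h(6) by blast
      then show ?thesis using h by (intro key[where \<nu> = \<nu> and K = K]) auto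
    qed
    ultimately show ?thesis by blast
  qed
  show ?thesis
    unfolding Let_def using part1 part2[OF _ _ refl refl] by blast
qed

end
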